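(* Let $p\ge 1$ be an integer and let $f(z)=z^p+\sum_{n=p+1}^\infty a_nz^n$ be analytic in $\mathbb D$. If $$\left|\arg\{f^{(p)}(z)\}\right|<\frac{3\pi}{4}\quad\text{for all } z\in\mathbb D,$$ then $$\left|\arg\left\{\frac{f^{(p-1)}(z)}{z}\right\}\right|<\frac{\pi}{2}\quad\text{for all } z\in\mathbb D,$$ and $$\mathfrak{Re}\left\{\frac{f^{(p-k-1)}(z)}{z^{k+1}}\right\}>0\quad\text{for all } z\in\mathbb D \text{ and all } k\in\{0,\ldots,p-1\}.$$ Moreover, if $p\geq 2$, then $f$ is $p$-valent in $\mathbb D$.
   Context: $\mathbb D=\{z\in\mathbb C:|z|<1\}$. $f^{(j)}$ is the $j$-th derivative of $f$, with $f^{(0)}=f$. Quotients such as $f^{(p-j)}(z)/z^{j}$ are understood at $z=0$ by their (removable-singularity) analytic extension. $\arg$ denotes the principal argument; a statement $|\arg w|<c$ includes that $w\neq 0$. A function $f$ analytic in a domain $D\subset\mathbb C$ is called $p$-valent in $D$ if for every complex number $w$ the equation $f(z)=w$ has at most $p$ roots in $D$ (roots counted with multiplicity), and there exists a complex number $w_0$ such that $f(z)=w_0$ has exactly $p$ roots in $D$. *)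

theory Defs
  imports
    "HOL-Complex_Analysis.Complex_Analysis"
    "HOL-Library.Extended_Nat"
begin

text \<open>
  The number of roots of \<open>f z = w\<close> in \<open>D\<close>, counted with multiplicity. The multiplicity of a root
  \<open>z\<close> is the order of vanishing of \<open>f - w\<close> at \<open>z\<close>; for \<open>f\<close> analytic on a domain this
  order is a positive integer whenever the root set is finite. A function with infinitely many
  roots, in particular the constant function \<open>w\<close> on a domain, gets the value \<open>\<infinity>\<close>.
\<close>

definition root_count :: "(complex \<Rightarrow> complex) \<Rightarrow> complex set \<Rightarrow> complex \<Rightarrow> enat" where
  "root_count f D w =
     (if finite {z \<in> D. f z = w}
      then enat (\<Sum>z | z \<in> D \<and> f z = w. nat (zorder (\<lambda>u. f u - w) z))
      else \<infinity>)"

definition p_valent_on :: "nat \<Rightarrow> (complex \<Rightarrow> complex) \<Rightarrow> complex set \<Rightarrow> bool" where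
  "p_valent_on p f D \<longleftrightarrow>
     open D \<and> connected D \<and> D \<noteq> {} \<and> f analytic_on D \<and>
     (\<forall>w. root_count f D w \<le> enat p) \<and>
     (\<exists>w\<^sub>0. root_count f D w\<^sub>0 = enat p)"

text \<open>
  \<open>|arg w| < c\<close> for the principal argument. Since \<open>Arg 0 = 0\<close> in the library, \<open>w \<noteq> 0\<close> has to be
  required separately.
\<close>

definition abs_arg_less :: "complex \<Rightarrow> real \<Rightarrow> bool" where
  "abs_arg_less w c \<longleftrightarrow> w \<noteq> 0 \<and> \<bar>Arg w\<bar> < c"

text \<open>
  The quotient \<open>f\<^sup>(\<^sup>m\<^sup>)(z) / z\<^sup>j\<close>, extended analytically over a removable singularity at \<open>0\<close>.
\<close>

definition deriv_quotient :: "(complex \<Rightarrow> complex) \<Rightarrow> nat \<Rightarrow> nat \<Rightarrow> complex \<Rightarrow> complex" where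
  "deriv_quotient f m j = remove_sings (\<lambda>z. (deriv ^^ m) f z / z ^ j)"

end

theory Submission
  imports Defs
begin

text \<open>
  Write \<open>f z = z\<^sup>p g z\<close>. Then \<open>f\<^sup>(\<^sup>m\<^sup>)(z) = z\<^sup>p\<^sup>-\<^sup>m G\<^sub>m(z)\<close> with \<open>G\<^sub>0 = g\<close> and
  \<open>G\<^sub>m\<^sub>+\<^sub>1 = (p - m) G\<^sub>m + z G\<^sub>m'\<close>, and the quotients in question are the \<open>G\<^sub>m\<close> with \<open>m < p\<close>.
  If \<open>q\<close> is holomorphic with \<open>q 0 > 0\<close> and \<open>Re q\<close> is not positive throughout the disc, let \<open>z\<close> be a
  zero of \<open>Re q\<close> of least modulus. The Schwarz lemma for \<open>(q - c) / (q + c)\<close>, \<open>c = q 0\<close>, shows that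
  \<open>z q' z = -s\<close> with \<open>s\<close> real, \<open>s > 0\<close> and \<open>s \<ge> \<bar>q z\<bar>\<close> (a form of the lemmas of Jack and Nunokawa).
  For \<open>m = p - 1\<close> this forces \<open>\<bar>arg G\<^sub>p(z)\<bar> \<ge> 3\<pi>/4\<close>, and for smaller \<open>m\<close> it forces
  \<open>Re G\<^sub>m\<^sub>+\<^sub>1(z) < 0\<close>; so \<open>Re G\<^sub>m > 0\<close> for all \<open>m < p\<close>.

  If \<open>p \<ge> 2\<close>, then \<open>h = G\<^sub>1\<close> has positive real part and \<open>z f' z = z\<^sup>p h z\<close>. Along \<open>\<bar>z\<bar> = r\<close>, whenever
  \<open>(f z - w) / z\<^sup>p\<close> is a negative real number, \<open>Re (z f' z / (f z - w)) < 0\<close>. Hence this quotient can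
  cross the negative real axis only clockwise, its winding number about \<open>0\<close> is at most \<open>0\<close>, and the
  argument principle bounds the number of roots of \<open>f z = w\<close> in \<open>\<bar>z\<bar> < r\<close> by \<open>p\<close>.
\<close>

section \<open>Sectors and half-planes\<close>

lemma abs_arg_less_pi_half_iff: "abs_arg_less w (pi / 2) \<longleftrightarrow> Re w > 0"
  using Re_Ln_pos_lt[of w] by (cases "w = 0") (auto simp: abs_arg_less_def Arg_eq_Im_Ln)

text \<open>With \<open>t = \<bar>Arg w\<bar>\<close> the sum is
  \<open>norm w * sqrt 2 * sin (t + pi / 4)\<close>, and \<open>t + pi / 4\<close> lies strictly
  between \<open>0\<close> and \<open>pi\<close>.\<close>

lemma abs_arg_less_three_quarter_pi:
  assumes "abs_arg_less w (3 * pi / 4)"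
  shows "0 < Re w + \<bar>Im w\<bar>"
proof -
  define t where "t = \<bar>Arg w\<bar>"
  have w: "w \<noteq> 0" "0 \<le> t" "t < 3 * pi / 4"
    using assms by (auto simp: abs_arg_less_def t_def)
  have polar: "w = of_real (norm w) * exp (\<i> * of_real (Arg w))"
    using Arg_eq w(1) by blast
  have Re: "Re w = norm w * cos t"
    by (subst polar) (simp add: Re_exp t_def)
  have "sin t \<ge> 0"
    using w by (intro sin_ge_zero) auto
  then have "\<bar>sin (Arg w)\<bar> = sin t"
    unfolding t_def by (cases "Arg w \<ge> 0") auto
  then have Im: "\<bar>Im w\<bar> = norm w * sin t"
    by (subst polar) (simp add: Im_exp abs_mult)
  have "0 < sin (t + pi / 4)"
    using w by (intro sin_gt_zero) auto
  then have "0 < sqrt 2 / 2 * (sin t + cos t)"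
    by (simp add: sin_add sin_45 cos_45 algebra_simps)
  then have "0 < sin t + cos t"
    by (simp add: zero_less_mult_iff)
  then have "0 < norm w * (sin t + cos t)"
    using w by simp
  then show ?thesis
    by (simp add: Re Im algebra_simps)
qed

section \<open>Schwarz lemma and the first zero of the real part\<close>

text \<open>The Moebius map \<open>(v - c) / (v + c)\<close> takes the right half-plane to the unit
  disc and \<open>c\<close> to \<open>0\<close>, so its composite \<open>W\<close> with
  \<open>q\<close> satisfies the Schwarz lemma.\<close>

lemma Schwarz_half_plane:
  assumes "q holomorphic_on ball 0 1" and "q 0 = complex_of_real c" and "0 < c"
    and "\<And>z. norm z < 1 \<Longrightarrow> Re (q z) > 0" and "norm z < 1"
  shows "norm (q z - of_real c) \<le> norm z * norm (q z + of_real c)"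
proof -
  define W where "W = (\<lambda>z. (q z - of_real c) / (q z + of_real c))"
  have nz: "q z + of_real c \<noteq> 0" if "norm z < 1" for z
    using assms(4)[OF that] \<open>0 < c\<close> by (auto simp: complex_eq_iff)
  have "W holomorphic_on ball 0 1"
    unfolding W_def using nz assms(1) by (intro holomorphic_intros) auto
  moreover have "W 0 = 0"
    by (simp add: W_def assms(2))
  moreover have "norm (W z) < 1" if "norm z < 1" for z
  proof -
    \<comment> \<open>The two squares differ by \<open>4 * c * Re (q z)\<close>.\<close>
    have "(norm (q z - of_real c))\<^sup>2 < (norm (q z + of_real c))\<^sup>2"
      using assms(4)[OF that] \<open>0 < c\<close>
      unfolding cmod_power2 by (simp add: power2_eq_square algebra_simps)
    then have "norm (q z - of_real c) < norm (q z + of_real c)"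
      by (rule power2_less_imp_less) simp
    then show ?thesis
      using nz[OF that] by (simp add: W_def norm_divide)
  qed
  ultimately have "norm (W z) \<le> norm z"
    using \<open>norm z < 1\<close> by (intro Schwarz_Lemma(1)[of W]) auto
  then show ?thesis
    using nz[OF \<open>norm z < 1\<close>] by (simp add: W_def norm_divide divide_simps)
qed

text \<open>Minimality on the circle makes \<open>z * deriv q z\<close> real; the Schwarz bound
  along the radius gives \<open>(Im (q z))\<^sup>2 + c\<^sup>2 \<le> 2 * c * s\<close>, whose left
  side is positive and at least \<open>2 * c * \<bar>Im (q z)\<bar>\<close>.\<close>

lemma first_zero_of_Re:
  assumes holo: "q holomorphic_on ball 0 1" and q0: "q 0 = complex_of_real c" and "0 < c"
    and ex: "\<exists>z\<in>ball 0 1. Re (q z) \<le> 0"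
  obtains z s where "z \<in> ball 0 1" "Re (q z) = 0" "z * deriv q z = - of_real s"
    "0 < s" "\<bar>Im (q z)\<bar> \<le> s"
proof -
  obtain z1 where z1: "z1 \<in> ball 0 1" "Re (q z1) \<le> 0"
    using ex by blast
  define K where "K = {z \<in> cball 0 (norm z1). Re (q z) \<le> 0}"
  have cont: "continuous_on (ball 0 1) (\<lambda>z. Re (q z))"
    using holo by (intro continuous_intros holomorphic_on_imp_continuous_on)
  have sub: "cball 0 (norm z1) \<subseteq> ball 0 1"
    using z1 by auto
  have "closed K"
    unfolding K_def
    by (intro continuous_on_closed_Collect_le continuous_on_const
        continuous_on_subset[OF cont sub]) auto
  moreover have "bounded K"
    by (rule bounded_subset[of "cball 0 (norm z1)"]) (auto simp: K_def)
  ultimately have "compact K"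
    by (simp add: compact_eq_bounded_closed)
  moreover have "K \<noteq> {}"
    using z1 by (auto simp: K_def)
  ultimately obtain z0 where z0: "z0 \<in> K" "\<And>z. z \<in> K \<Longrightarrow> norm z0 \<le> norm z"
    using continuous_attains_inf[of K norm] by (auto intro: continuous_intros)
  define r where "r = norm z0"
  have z0b: "z0 \<in> ball 0 1" "Re (q z0) \<le> 0"
    using z0(1) z1(1) by (auto simp: K_def)
  have "z0 \<noteq> 0"
    using z0b(2) q0 \<open>0 < c\<close> by auto
  then have r: "0 < r" "r < 1"
    using z0b by (auto simp: r_def)
  have inside: "Re (q z) > 0" if "norm z < r" for z
    using z0(2)[of z] that z0(1) by (force simp: K_def r_def)
  have ge: "Re (q z) \<ge> 0" if "norm z \<le> r" for z
  proof (rule continuous_ge_on_closure[where S = "ball 0 r" and f = "\<lambda>z. Re (q z)"])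
    show "continuous_on (closure (ball 0 r)) (\<lambda>z. Re (q z))"
      using r by (intro continuous_on_subset[OF cont]) auto
  qed (use that r inside in \<open>auto intro: less_imp_le\<close>)
  have Re0: "Re (q z0) = 0"
    using ge[of z0] z0b by (simp add: r_def)
  define D where "D = z0 * deriv q z0"
  have deriv: "((\<lambda>t. q (g t)) has_vector_derivative k * deriv q z0) (at x)"
    if "(g has_vector_derivative k) (at x)" "g x = z0" for g :: "real \<Rightarrow> complex" and k x
    using field_vector_diff_chain_at[OF that(1), of q "deriv q z0"] that(2) z0b holo
    by (simp add: o_def holomorphic_derivI[OF holo])
  \<comment> \<open>On the circle through \<open>z0\<close> the minimum of \<open>Re q\<close> is attained at \<open>z0\<close>, so the tangential
    derivative vanishes there.\<close>
  have "((\<lambda>t. z0 * exp (\<i> * of_real t)) has_vector_derivative \<i> * z0) (at 0)"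
    by (auto intro!: derivative_eq_intros has_vector_derivative_real_field)
  from deriv[OF this] have "((\<lambda>t. Re (q (z0 * exp (\<i> * of_real t)))) has_field_derivative Re (\<i> * D)) (at 0)"
    using has_field_derivative_Re by (force simp: D_def mult.assoc)
  then have "Re (\<i> * D) = 0"
    by (rule DERIV_local_min[where d = 1]) (auto simp: Re0 norm_mult r_def intro!: ge)
  then have ImD: "Im D = 0"
    by simp
  have "((\<lambda>t. of_real t * z0) has_vector_derivative z0) (at 1)"
    by (auto intro!: derivative_eq_intros has_vector_derivative_real_field)
  from deriv[OF this] have Q: "((\<lambda>t. q (of_real t * z0)) has_vector_derivative D) (at 1)"
    by (simp add: D_def)
  \<comment> \<open>\<open>F t \<ge> 0\<close> is the squared Schwarz inequality \<open>\<bar>Q - c\<bar>\<^sup>2 \<le> t\<^sup>2 \<bar>Q + c\<bar>\<^sup>2\<close> for \<open>Q = q (t * z0)\<close>;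
    since \<open>F 1 = 0\<close>, the derivative of \<open>F\<close> at \<open>1\<close> is not positive.\<close>
  define F where "F = (\<lambda>t. 2 * c * Re (q (of_real t * z0)) * (1 + t\<^sup>2)
      - (1 - t\<^sup>2) * ((Re (q (of_real t * z0)))\<^sup>2 + (Im (q (of_real t * z0)))\<^sup>2 + c\<^sup>2))"
  have F1: "F 1 = 0"
    by (simp add: F_def Re0)
  have F': "(F has_field_derivative 4 * c * Re D + 2 * ((Im (q z0))\<^sup>2 + c\<^sup>2)) (at 1)"
    unfolding F_def
    by (rule derivative_eq_intros refl has_field_derivative_Re[OF Q] has_field_derivative_Im[OF Q])+
      (simp add: Re0 algebra_simps)
  have F_nonneg: "F t \<ge> 0" if "0 < t" "t < 1" for t
  proof -
    \<comment> \<open>Scaling by \<open>z0\<close> carries the unit disc into the disc of radius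
      \<open>r\<close>, where \<open>Re q\<close> is positive.\<close>
    have "norm (q (z0 * of_real t) - of_real c) \<le> norm (of_real t :: complex) * norm (q (z0 * of_real t) + of_real c)"
    proof (rule Schwarz_half_plane[where q = "\<lambda>u. q (z0 * u)"])
      have "(q \<circ> (\<lambda>u. z0 * u)) holomorphic_on ball 0 1"
      proof (intro holomorphic_on_compose_gen[OF _ holo] holomorphic_intros)
        show "(*) z0 ` ball 0 1 \<subseteq> ball 0 1"
        proof
          fix v assume "v \<in> (*) z0 ` ball 0 1"
          then obtain u where u: "v = z0 * u" "norm u < 1"
            by (metis imageE mem_ball_0)
          then have "norm v \<le> r"
            using r by (auto simp: norm_mult r_def intro!: mult_left_le)
          then show "v \<in> ball 0 1"
            using r by simp
        qed
      qed
      then show "(\<lambda>u. q (z0 * u)) holomorphic_on ball 0 1"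
        by (simp add: o_def)
      show "Re (q (z0 * u)) > 0" if "norm u < 1" for u
        using that r by (intro inside) (simp add: norm_mult r_def)
    qed (use that q0 \<open>0 < c\<close> in auto)
    then have "(norm (q (z0 * of_real t) - of_real c))\<^sup>2 \<le> (norm (of_real t :: complex) * norm (q (z0 * of_real t) + of_real c))\<^sup>2"
      by (rule power_mono) simp
    then show ?thesis
      by (simp add: F_def cmod_power2 power_mult_distrib mult.commute[of _ z0])
        (simp add: power2_eq_square algebra_simps)
  qed
  have "4 * c * Re D + 2 * ((Im (q z0))\<^sup>2 + c\<^sup>2) \<le> 0"
  proof (rule ccontr)
    assume "\<not> ?thesis"
    then obtain d where d: "d > 0" "\<And>h. \<lbrakk>0 < h; h < d\<rbrakk> \<Longrightarrow> F (1 - h) < F 1"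
      using DERIV_pos_inc_left[OF F'] by force
    have "F (1 - min d 1 / 2) < F 1"
      using d by (intro d(2)) auto
    with F_nonneg[of "1 - min d 1 / 2"] F1 d(1) show False
      by (auto simp: min_def split: if_splits)
  qed
  then have le: "(Im (q z0))\<^sup>2 + c\<^sup>2 \<le> 2 * c * (- Re D)"
    by simp
  have "2 * c * \<bar>Im (q z0)\<bar> \<le> (Im (q z0))\<^sup>2 + c\<^sup>2"
    using zero_le_power2[of "\<bar>Im (q z0)\<bar> - c"] by (simp add: power2_diff algebra_simps)
  with le have "2 * c * \<bar>Im (q z0)\<bar> \<le> 2 * c * (- Re D)"
    by linarith
  then have bound: "\<bar>Im (q z0)\<bar> \<le> - Re D"
    using \<open>0 < c\<close> by (subst (asm) mult_le_cancel_left_pos) auto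
  have "0 < (Im (q z0))\<^sup>2 + c\<^sup>2"
    using \<open>0 < c\<close> by (simp add: add_nonneg_pos)
  with le have "0 < 2 * c * (- Re D)"
    by linarith
  then have pos: "0 < - Re D"
    using \<open>0 < c\<close> by (subst (asm) zero_less_mult_iff) auto
  show ?thesis
    using that[of z0 "- Re D"] z0b Re0 bound pos ImD
    by (auto simp: D_def complex_eq_iff)
qed

section \<open>Positivity of the real part\<close>

lemma Re_pos_of_euler_sum:
  assumes "q holomorphic_on ball 0 1" and "q 0 = complex_of_real c" and "0 < c" and "0 < n"
    and "\<And>z. z \<in> ball 0 1 \<Longrightarrow> Re (of_nat n * q z + z * deriv q z) > 0" and "z \<in> ball 0 1"
  shows "Re (q z) > 0"
proof (rule ccontr)
  assume "\<not> ?thesis"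
  then have "\<exists>z\<in>ball 0 1. Re (q z) \<le> 0"
    using assms(6) by (auto simp: not_less)
  then obtain u s where "u \<in> ball 0 1" "Re (q u) = 0" "u * deriv q u = - of_real s" "0 < s"
    using first_zero_of_Re[OF assms(1-3)] by metis
  with assms(5)[of u] show False
    by simp
qed

text \<open>At a first zero of \<open>Re q\<close> the sum has real part \<open>-s\<close> and
  imaginary part of modulus at most \<open>s\<close>, which puts it outside the sector.\<close>

lemma Re_pos_of_abs_arg_less:
  assumes "q holomorphic_on ball 0 1" and "q 0 = complex_of_real c" and "0 < c"
    and "\<And>z. z \<in> ball 0 1 \<Longrightarrow> abs_arg_less (q z + z * deriv q z) (3 * pi / 4)" and "z \<in> ball 0 1"
  shows "Re (q z) > 0"
proof (rule ccontr)
  assume "\<not> ?thesis"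
  then have "\<exists>z\<in>ball 0 1. Re (q z) \<le> 0"
    using assms(5) by (auto simp: not_less)
  then obtain u s where "u \<in> ball 0 1" "Re (q u) = 0" "u * deriv q u = - of_real s"
    "\<bar>Im (q u)\<bar> \<le> s"
    using first_zero_of_Re[OF assms(1-3)] by metis
  with abs_arg_less_three_quarter_pi[OF assms(4)[of u]] show False
    by simp
qed

section \<open>Counting roots by the argument principle\<close>

text \<open>Odd multiples of \<open>pi\<close> can only be crossed downwards, whereas an increase by
  \<open>2 * pi\<close> would have to reach one of them from below.\<close>

lemma increase_less_two_pi:
  fixes \<phi> :: "real \<Rightarrow> real"
  assumes deriv: "\<And>x. x \<in> {0..1} \<Longrightarrow> (\<phi> has_real_derivative \<phi>' x) (at x within {0..1})"
    and neg: "\<And>x k. \<lbrakk>x \<in> {0..1}; \<phi> x = pi + 2 * pi * of_int k\<rbrakk> \<Longrightarrow> \<phi>' x < 0"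
  shows "\<phi> 1 < \<phi> 0 + 2 * pi"
proof (rule ccontr)
  assume large: "\<not> ?thesis"
  \<comment> \<open>This makes \<open>c\<close> the least odd multiple of \<open>pi\<close> above
    \<open>\<phi> 0\<close>.\<close>
  define k where "k = \<lfloor>(\<phi> 0 - pi) / (2 * pi)\<rfloor> + 1"
  define c where "c = pi + 2 * pi * of_int k"
  have "(\<phi> 0 - pi) / (2 * pi) < of_int k" "of_int k \<le> (\<phi> 0 - pi) / (2 * pi) + 1"
    unfolding k_def by linarith+
  then have c: "\<phi> 0 < c" "c \<le> \<phi> 0 + 2 * pi"
    by (auto simp: c_def field_simps)
  have cont: "continuous_on {0..1} \<phi>"
    using deriv DERIV_continuous continuous_on_eq_continuous_within by blast
  define K where "K = {x \<in> {0..1}. c \<le> \<phi> x}"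
  have "closed K"
    unfolding K_def by (intro continuous_on_closed_Collect_le continuous_on_const cont) auto
  moreover have "bounded K"
    by (rule bounded_subset[of "{0..1}"]) (auto simp: K_def)
  ultimately have "compact K"
    by (simp add: compact_eq_bounded_closed)
  moreover have "1 \<in> K"
    using large c by (auto simp: K_def)
  ultimately obtain x where x: "x \<in> K" "\<And>y. y \<in> K \<Longrightarrow> x \<le> y"
    using compact_attains_inf[of K] by auto
  then have x01: "x \<in> {0..1}" "c \<le> \<phi> x"
    by (auto simp: K_def)
  obtain y where y: "0 \<le> y" "y \<le> x" "\<phi> y = c"
    using IVT'[of \<phi> 0 c x] c x01 continuous_on_subset[OF cont, of "{0..x}"] by auto
  then have "y \<in> K"
    using x01 by (auto simp: K_def)
  then have \<phi>x: "\<phi> x = c"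
    using x(2) y by force
  then have "x \<noteq> 0"
    using c by auto
  \<comment> \<open>A negative derivative at \<open>x\<close> puts \<open>\<phi>\<close> above
    \<open>c\<close> just before \<open>x\<close>, although \<open>x\<close> is the first point of
    \<open>K\<close>.\<close>
  obtain d where d: "d > 0" "\<And>h. \<lbrakk>0 < h; x - h \<in> {0..1}; h < d\<rbrakk> \<Longrightarrow> \<phi> x < \<phi> (x - h)"
    using has_real_derivative_neg_dec_left[OF deriv[OF x01(1)] neg[OF x01(1), of k]] \<phi>x
    by (auto simp: c_def)
  define h where "h = min x d / 2"
  have h: "0 < h" "h < d" "h \<le> x"
    using d(1) x01(1) \<open>x \<noteq> 0\<close> by (auto simp: h_def min_def)
  then have "x - h \<in> {0..1}"
    using x01 by auto
  with d(2)[of h] h \<phi>x have "x - h \<in> K"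
    by (auto simp: K_def)
  with x(2) h show False
    by force
qed

text \<open>If \<open>N\<close> is the sum, the argument of \<open>(f z - w) / z ^ p\<close> grows
  by \<open>2 * pi * (N - p)\<close> along the circle. This is less than \<open>2 * pi\<close>, and
  \<open>N\<close> is an integer.\<close>

lemma sum_zorder_le:
  assumes holf: "f holomorphic_on ball 0 1" and "\<not> f constant_on ball 0 1"
    and f': "\<And>z. z \<in> ball 0 1 \<Longrightarrow> z * deriv f z = z ^ p * h z"
    and h: "\<And>z. z \<in> ball 0 1 \<Longrightarrow> Re (h z) > 0"
    and r: "0 < r" "r < 1" and nz: "\<And>z. norm z = r \<Longrightarrow> f z \<noteq> w"
  shows "(\<Sum>z | z \<in> ball 0 r \<and> f z = w. zorder (\<lambda>u. f u - w) z) \<le> int p"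
proof -
  define F where "F = (\<lambda>z. f z - w)"
  have holF: "F holomorphic_on ball 0 1"
    unfolding F_def by (intro holomorphic_intros holf)
  have derivF: "deriv F z = deriv f z" if "z \<in> ball 0 1" for z
    using holomorphic_derivI[OF holf _ that] unfolding F_def
    by (intro DERIV_imp_deriv) (auto intro!: derivative_eq_intros)
  define R where "R = (r + 1) / 2"
  have R: "r < R" "R < 1" "0 < R"
    using r by (auto simp: R_def)
  have F_nonconst: "\<not> F constant_on ball 0 1"
    using assms(2) unfolding F_def constant_on_def by (metis diff_add_cancel)
  have "finite {z \<in> cball 0 R. F z = 0}"
    using R F_nonconst by (intro holomorphic_compact_finite_zeros[OF holF]) auto
  then have fin: "finite {z \<in> ball 0 R. F z = 0}"
    by (rule rev_finite_subset) auto
  define e where "e = circlepath 0 r"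
  have e: "e x = of_real r * exp (2 * of_real pi * \<i> * of_real x)" for x
    by (simp add: e_def circlepath)
  have norm_e: "norm (e x) = r" for x
    using r by (simp add: e norm_mult)
  have Fe: "F (e x) \<noteq> 0" for x
    using nz[OF norm_e] by (simp add: F_def)
  have e': "(e has_vector_derivative 2 * of_real pi * \<i> * e x) (at x within X)" for x X
    using has_vector_derivative_circlepath[of 0 r x X] by (simp add: e_def[symmetric] e mult_ac)
  define N where "N = (\<Sum>z | z \<in> ball 0 r \<and> F z = 0. zorder F z)"
  have "contour_integral e (\<lambda>z. deriv F z * 1 / F z) =
      2 * pi * \<i> * (\<Sum>z\<in>{z \<in> ball 0 R. F z = 0 \<or> z \<in> {}}. winding_number e z * 1 * zorder F z)"
  proof (rule argument_principle)
    show "F holomorphic_on ball 0 R - {}"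
      using R by (auto intro: holomorphic_on_subset[OF holF])
    show "path_image e \<subseteq> ball 0 R - {z \<in> ball 0 R. F z = 0 \<or> z \<in> {}}"
      using R Fe norm_e by (auto simp: path_image_def)
    show "\<forall>z. z \<notin> ball 0 R \<longrightarrow> winding_number e z = 0"
    proof (intro allI impI)
      fix z :: complex assume "z \<notin> ball 0 R"
      then show "winding_number e z = 0"
        using R r unfolding e_def
        by (intro winding_number_zero_outside[of _ "cball 0 r"]) auto
    qed
  qed (use fin in \<open>auto simp: e_def\<close>)
  \<comment> \<open>Zeros beyond the circle have winding number \<open>0\<close>, and none lies on
    it.\<close>
  also have "(\<Sum>z\<in>{z \<in> ball 0 R. F z = 0 \<or> z \<in> {}}. winding_number e z * 1 * zorder F z)
      = (\<Sum>z | z \<in> ball 0 r \<and> F z = 0. of_int (zorder F z))"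
  proof (rule sum.mono_neutral_cong_right)
    show "\<forall>i\<in>{z \<in> ball 0 R. F z = 0 \<or> z \<in> {}} - {z \<in> ball 0 r. F z = 0}.
        winding_number e i * 1 * of_int (zorder F i) = 0"
    proof
      fix z assume z: "z \<in> {z \<in> ball 0 R. F z = 0 \<or> z \<in> {}} - {z \<in> ball 0 r. F z = 0}"
      then have "norm z > r"
        using nz[of z] by (force simp: F_def)
      then have "winding_number e z = 0"
        using r unfolding e_def
        by (intro winding_number_zero_outside[of _ "cball 0 r"]) auto
      then show "winding_number e z * 1 * of_int (zorder F z) = 0"
        by simp
    qed
    show "winding_number e z * 1 * of_int (zorder F z) = of_int (zorder F z)"
      if "z \<in> {z \<in> ball 0 r. F z = 0}" for z
      using that by (simp add: e_def winding_number_circlepath)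
  qed (use fin R in auto)
  finally have arg_princ: "contour_integral e (\<lambda>z. deriv F z / F z) = 2 * pi * \<i> * of_int N"
    by (simp add: N_def)
  define G where "G = (\<lambda>x. deriv F (e x) / F (e x) * (2 * of_real pi * \<i> * e x))"
  have "integral {0..1} G = 2 * pi * \<i> * of_int N"
    using arg_princ by (simp add: contour_integral_integral G_def vector_derivative_at[OF e'])
  moreover have contG: "continuous_on {0..1} G"
  proof -
    have cont_e: "continuous_on {0..1} e"
      by (rule continuous_on_vector_derivative) (rule e')
    have sub: "e ` {0..1} \<subseteq> ball 0 1"
      using norm_e r by auto
    have "continuous_on (ball 0 1) F" "continuous_on (ball 0 1) (deriv F)"
      by (auto intro!: holomorphic_on_imp_continuous_on holF holomorphic_deriv)
    from this[THEN continuous_on_compose2, OF cont_e sub]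
    show ?thesis
      unfolding G_def using Fe by (intro continuous_intros cont_e) auto
  qed
  \<comment> \<open>\<open>G\<close> is the logarithmic derivative of \<open>F (e x)\<close>, so
    \<open>I\<close> is a continuous logarithm of \<open>F\<close> along the circle.\<close>
  define I where "I = (\<lambda>x. Ln (F (e 0)) + integral {0..x} G)"
  have I': "(I has_vector_derivative G x) (at x within {0..1})" if "x \<in> {0..1}" for x
    unfolding I_def by (auto intro!: derivative_eq_intros integral_has_vector_derivative contG that)
  have exp_I: "exp (I x) = F (e x)" if "x \<in> {0..1}" for x
  proof -
    have "\<exists>c. \<forall>x\<in>{0..1}. F (e x) * exp (- I x) = c"
    proof (rule has_vector_derivative_zero_constant)
      fix x :: real assume x: "x \<in> {0..1}"
      have ex: "e x \<in> ball 0 1"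
        using norm_e r by simp
      have "((F \<circ> e) has_vector_derivative (2 * of_real pi * \<i> * e x) * deriv F (e x)) (at x within {0..1})"
        using ex by (intro field_vector_diff_chain_within e' DERIV_subset[OF holomorphic_derivI[OF holF]]) auto
      moreover have "((exp \<circ> (\<lambda>x. - I x)) has_vector_derivative (- G x) * exp (- I x)) (at x within {0..1})"
        by (intro field_vector_diff_chain_within derivative_intros I'[OF x]) (auto intro: DERIV_exp DERIV_subset)
      ultimately have "((\<lambda>x. F (e x) * exp (- I x)) has_vector_derivative
          F (e x) * ((- G x) * exp (- I x)) + ((2 * of_real pi * \<i> * e x) * deriv F (e x)) * exp (- I x)) (at x within {0..1})"
        unfolding o_def by (rule has_vector_derivative_mult)
      then show "((\<lambda>x. F (e x) * exp (- I x)) has_vector_derivative 0) (at x within {0..1})"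
        using Fe[of x] by (simp add: G_def)
    qed auto
    then obtain c where c: "\<And>x. x \<in> {0..1} \<Longrightarrow> F (e x) * exp (- I x) = c"
      by blast
    have "c = 1"
      using c[of 0] Fe[of 0] by (simp add: I_def exp_minus)
    with c[OF that] show ?thesis
      by (simp add: exp_minus divide_simps)
  qed
  \<comment> \<open>a continuous argument of \<open>F (e x) / (e x / r) ^ p\<close>\<close>
  define \<phi> where "\<phi> = (\<lambda>x. Im (I x) - 2 * pi * p * x)"
  have "\<phi> 1 < \<phi> 0 + 2 * pi"
  proof (rule increase_less_two_pi)
    fix x :: real assume x: "x \<in> {0..1}"
    show "(\<phi> has_real_derivative Im (G x) - 2 * pi * p) (at x within {0..1})"
      unfolding \<phi>_def
      by (auto intro!: derivative_eq_intros has_field_derivative_Im I'[OF x])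
  next
    fix x :: real and k :: int
    assume x: "x \<in> {0..1}" and k: "\<phi> x = pi + 2 * pi * of_int k"
    \<comment> \<open>An argument that is an odd multiple of \<open>pi\<close> means that the
      quotient is the negative real number \<open>- \<rho>\<close>.\<close>
    define \<rho> where "\<rho> = exp (Re (I x))"
    have "I x = of_real (Re (I x)) + 2 * of_real pi * \<i> * of_nat p * of_real x + pi * \<i> + 2 * of_int k * of_real pi * \<i>"
      using k by (intro complex_eqI) (simp_all add: \<phi>_def algebra_simps)
    then have "F (e x) = exp (of_real (Re (I x)) + 2 * of_real pi * \<i> * of_nat p * of_real x + pi * \<i> + 2 * of_int k * of_real pi * \<i>)"
      using exp_I[OF x] by simp
    also have "\<dots> = - of_real \<rho> * exp (2 * of_real pi * \<i> * of_real x) ^ p"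
      by (simp add: exp_add \<rho>_def exp_of_real exp_of_nat_mult[symmetric] exp_integer_2pi algebra_simps)
    finally have Fex: "F (e x) = - of_real \<rho> * exp (2 * of_real pi * \<i> * of_real x) ^ p" .
    have ex: "e x \<in> ball 0 1"
      using norm_e r by simp
    have "G x = 2 * of_real pi * \<i> * (e x * deriv f (e x)) / F (e x)"
      by (simp add: G_def derivF[OF ex])
    \<comment> \<open>By \<open>f'\<close> the numerator contains \<open>e x ^ p\<close>, whose
      unimodular part cancels against that of \<open>F (e x)\<close>; a real factor times
      \<open>h (e x)\<close> remains.\<close>
    also have "\<dots> = of_real (- 2 * pi * r ^ p / \<rho>) * \<i> * h (e x)"
      unfolding f'[OF ex] Fex using r by (simp add: e power_mult_distrib \<rho>_def)
    finally have "G x = of_real (- 2 * pi * r ^ p / \<rho>) * \<i> * h (e x)" .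
    moreover have "Im (of_real a * \<i> * v) = a * Re v" for a v
      by simp
    ultimately have "Im (G x) = (- 2 * pi * r ^ p / \<rho>) * Re (h (e x))"
      by metis
    also have "\<dots> < 0"
      using h[OF ex] r by (auto simp: \<rho>_def intro!: mult_neg_pos divide_neg_pos)
    finally have "Im (G x) < 0" .
    moreover have "0 \<le> 2 * pi * p"
      by simp
    ultimately show "Im (G x) - 2 * pi * p < 0"
      by linarith
  qed
  moreover have "\<phi> 1 = \<phi> 0 + 2 * pi * of_int N - 2 * pi * p"
    using \<open>integral {0..1} G = 2 * pi * \<i> * of_int N\<close> by (simp add: \<phi>_def I_def)
  ultimately have "2 * pi * (of_int N - of_nat p) < 2 * pi * 1"
    by (simp add: algebra_simps)
  then have "real_of_int N - real p < 1"
    by (subst (asm) mult_less_cancel_left_pos) auto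
  then have "N \<le> int p"
    by linarith
  then show ?thesis
    by (simp add: N_def F_def)
qed

text \<open>Finiteness of the root set is not known in advance, so finite subsets \<open>T\<close>
  are bounded first; as each order is at least \<open>1\<close>, this also bounds
  \<open>card T\<close>.\<close>

lemma root_count_le:
  assumes holf: "f holomorphic_on ball 0 1" and nonconst: "\<not> f constant_on ball 0 1"
    and f': "\<And>z. z \<in> ball 0 1 \<Longrightarrow> z * deriv f z = z ^ p * h z"
    and h: "\<And>z. z \<in> ball 0 1 \<Longrightarrow> Re (h z) > 0"
  shows "root_count f (ball 0 1) w \<le> enat p"
proof -
  define Z where "Z = {z \<in> ball 0 1. f z = w}"
  define ord where "ord = (\<lambda>z. zorder (\<lambda>u. f u - w) z)"
  have holF: "(\<lambda>u. f u - w) holomorphic_on ball 0 1"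
    by (intro holomorphic_intros holf)
  have nonconstF: "\<not> (\<lambda>u. f u - w) constant_on ball 0 1"
    using nonconst unfolding constant_on_def by (metis diff_add_cancel)
  have ord_pos: "ord z > 0" if "z \<in> Z" for z
  proof -
    have "\<exists>u\<in>ball 0 1. f u - w \<noteq> 0"
      using nonconstF unfolding constant_on_def by blast
    then show ?thesis
      using zorder_exist_zero[OF holF, of z] that by (simp add: Z_def ord_def)
  qed
  have bound: "(\<Sum>z\<in>T. ord z) \<le> int p" if T: "finite T" "T \<subseteq> Z" for T
  proof -
    \<comment> \<open>Inserting \<open>0\<close> covers the case of empty \<open>T\<close>.\<close>
    define R0 where "R0 = Max (insert 0 (norm ` T))"
    have "R0 < 1"
      using T by (auto simp: R0_def Z_def)
    have norm_T: "norm z \<le> R0" if "z \<in> T" for z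
      using T(1) that by (auto simp: R0_def)
    have R0: "0 \<le> R0"
      using T(1) by (simp add: R0_def)
    define R where "R = (R0 + 1) / 2"
    have R: "R0 < R" "R < 1"
      using \<open>R0 < 1\<close> by (auto simp: R_def)
    have "finite {z \<in> cball 0 R. f z - w = 0}"
      using R by (intro holomorphic_compact_finite_zeros[OF holF _ _ _ _ nonconstF]) auto
    then have finR: "finite {z \<in> cball 0 R. f z = w}"
      by simp
    \<comment> \<open>Only finitely many radii meet a root, so some circle around \<open>T\<close>
      avoids them all.\<close>
    have "infinite ({R0<..<R} - norm ` {z \<in> cball 0 R. f z = w})"
      using R finR by (intro Diff_infinite_finite) auto
    then have "{R0<..<R} - norm ` {z \<in> cball 0 R. f z = w} \<noteq> {}"
      by (metis finite.emptyI)
    then obtain r where r: "R0 < r" "r < R" "r \<notin> norm ` {z \<in> cball 0 R. f z = w}"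
      by (meson DiffE all_not_in_conv greaterThanLessThan_iff)
    have "(\<Sum>z\<in>T. ord z) \<le> (\<Sum>z | z \<in> ball 0 r \<and> f z = w. ord z)"
    proof (rule sum_mono2)
      show "finite {z \<in> ball 0 r. f z = w}"
        using r by (intro finite_subset[OF _ finR]) auto
      show "T \<subseteq> {z \<in> ball 0 r. f z = w}"
        using T(2) norm_T r by (force simp: Z_def)
      show "0 \<le> ord z" if "z \<in> {z \<in> ball 0 r. f z = w} - T" for z
        using that r R by (intro less_imp_le ord_pos) (auto simp: Z_def)
    qed
    also have "\<dots> \<le> int p"
      unfolding ord_def
    proof (rule sum_zorder_le[OF holf nonconst f' h])
      show "f z \<noteq> w" if "norm z = r" for z
        using r R that by force
    qed (use r R R0 in auto)
    finally show ?thesis .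
  qed
  have card: "card T \<le> p" if "finite T" "T \<subseteq> Z" for T
  proof -
    have "int (card T) = (\<Sum>z\<in>T. 1)"
      by simp
    also have "\<dots> \<le> (\<Sum>z\<in>T. ord z)"
      using that ord_pos by (intro sum_mono) force
    also have "\<dots> \<le> int p"
      using bound that by blast
    finally show ?thesis
      by simp
  qed
  have "finite Z"
  proof (rule ccontr)
    assume "infinite Z"
    then obtain T where "T \<subseteq> Z" "finite T" "card T = Suc p"
      using infinite_arbitrarily_large by blast
    with card[of T] show False
      by simp
  qed
  have "int (\<Sum>z\<in>Z. nat (ord z)) = (\<Sum>z\<in>Z. ord z)"
    using ord_pos by (auto intro!: sum.cong simp: less_imp_le)
  also have "\<dots> \<le> int p"
    using bound \<open>finite Z\<close> by blast
  finally have "(\<Sum>z\<in>Z. nat (ord z)) \<le> p"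
    by (simp only: of_nat_le_iff)
  then show ?thesis
    using \<open>finite Z\<close> by (simp add: root_count_def Z_def ord_def)
qed

section \<open>Valence from positive real part\<close>

text \<open>The value \<open>0\<close> attains the bound: its only root is the origin, with order
  \<open>p\<close>.\<close>

lemma p_valent_on_of_Re_pos:
  assumes f: "\<And>z. z \<in> ball 0 1 \<Longrightarrow> f z = z ^ p * g z" and holg: "g holomorphic_on ball 0 1"
    and g: "\<And>z. z \<in> ball 0 1 \<Longrightarrow> g z \<noteq> 0" and "p > 0"
    and holf: "f holomorphic_on ball 0 1"
    and f': "\<And>z. z \<in> ball 0 1 \<Longrightarrow> z * deriv f z = z ^ p * h z"
    and h: "\<And>z. z \<in> ball 0 1 \<Longrightarrow> Re (h z) > 0"
  shows "p_valent_on p f (ball 0 1)"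
proof -
  have zero_iff: "f z = 0 \<longleftrightarrow> z = 0" if "z \<in> ball 0 1" for z
    using f[OF that] g[OF that] \<open>p > 0\<close> by simp
  then have zeros: "{z \<in> ball 0 1. f z = 0} = {0}"
    by auto
  have "\<not> f constant_on ball 0 1"
  proof
    assume "f constant_on ball 0 1"
    then obtain c where "\<And>z. z \<in> ball 0 1 \<Longrightarrow> f z = c"
      unfolding constant_on_def by blast
    from this[of "1 / 2"] this[of 0] show False
      using zero_iff[of "1 / 2"] zero_iff[of 0] by simp
  qed
  have "zorder f 0 = int p"
  proof (rule zorder_eqI[OF _ _ holg])
    show "g 0 \<noteq> 0"
      using g by simp
    show "f z = g z * (z - 0) powi int p" if "z \<in> ball 0 1" for z
      using f[OF that] by simp
  qed auto
  then have "root_count f (ball 0 1) 0 = enat p"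
    using zeros by (simp add: root_count_def)
  then show ?thesis
    unfolding p_valent_on_def
    using root_count_le[OF holf \<open>\<not> f constant_on ball 0 1\<close> f' h] holf
    by (auto simp: analytic_on_open)
qed

section \<open>Derivative quotients and cofactors\<close>

lemma deriv_quotient_eq:
  assumes "q holomorphic_on ball 0 1" and "z \<in> ball 0 1"
    and "\<And>z. z \<in> ball 0 1 \<Longrightarrow> (deriv ^^ m) f z = z ^ j * q z"
  shows "deriv_quotient f m j z = q z"
  unfolding deriv_quotient_def
proof (rule remove_sings_eqI)
  have "isCont q z"
    using assms(1,2) holomorphic_on_imp_continuous_on continuous_on_interior by fastforce
  then have "q \<midarrow>z\<rightarrow> q z"
    by (simp add: isCont_def)
  moreover have "\<forall>\<^sub>F x in at z. x \<in> ball 0 1 - {0}"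
  proof (cases "z = 0")
    case True
    then show ?thesis
      using eventually_at_in_open[of "ball 0 1" z] assms(2) by simp
  next
    case False
    then show ?thesis
      using assms(2) by (intro eventually_at_in_open') auto
  qed
  then have "\<forall>\<^sub>F x in at z. q x = (deriv ^^ m) f x / x ^ j"
    by eventually_elim (use assms(3) in auto)
  ultimately show "(\<lambda>x. (deriv ^^ m) f x / x ^ j) \<midarrow>z\<rightarrow> q z"
    by (rule Lim_transform_eventually)
qed

text \<open>These are the functions \<open>G\<^sub>m\<close> of the overview; the recursion is the
  product rule for \<open>z ^ (p - m) * G\<^sub>m z\<close> with one power of \<open>z\<close> fewer
  taken out.\<close>

primrec deriv_cofactor :: "nat \<Rightarrow> (complex \<Rightarrow> complex) \<Rightarrow> nat \<Rightarrow> complex \<Rightarrow> complex" where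
  "deriv_cofactor p g 0 = g"
| "deriv_cofactor p g (Suc m) =
    (\<lambda>z. of_nat (p - m) * deriv_cofactor p g m z + z * deriv (deriv_cofactor p g m) z)"

lemma holomorphic_deriv_cofactor:
  assumes "open S" "g holomorphic_on S"
  shows "deriv_cofactor p g m holomorphic_on S"
  using assms by (induction m) (auto intro!: holomorphic_intros)

lemma higher_deriv_cofactor:
  assumes S: "open S" "g holomorphic_on S" and f: "\<And>z. z \<in> S \<Longrightarrow> f z = z ^ p * g z"
  shows "m \<le> p \<Longrightarrow> z \<in> S \<Longrightarrow> (deriv ^^ m) f z = z ^ (p - m) * deriv_cofactor p g m z"
proof (induction m arbitrary: z)
  case 0
  then show ?case
    using f by simp
next
  case (Suc m)
  define G where "G = deriv_cofactor p g m"
  have holG: "G holomorphic_on S"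
    unfolding G_def using S by (rule holomorphic_deriv_cofactor)
  obtain k where k: "p - m = Suc k" "p - Suc m = k"
    using Suc.prems(1) by (metis Suc_diff_Suc Suc_le_lessD)
  \<comment> \<open>Differentiating at \<open>z\<close> needs the formula on a whole
    neighbourhood.\<close>
  have "\<forall>\<^sub>F x in nhds z. (deriv ^^ m) f x = x ^ Suc k * G x"
    using eventually_nhds_in_open[OF S(1) Suc.prems(2)]
    by eventually_elim (use Suc.IH Suc.prems k in \<open>simp add: G_def\<close>)
  then have "(deriv ^^ Suc m) f z = deriv (\<lambda>x. x ^ Suc k * G x) z"
    by (simp add: deriv_cong_ev)
  also have "\<dots> = z ^ k * (of_nat (Suc k) * G z + z * deriv G z)"
    by (rule DERIV_imp_deriv, (rule derivative_eq_intros refl holomorphic_derivI[OF holG S(1) Suc.prems(2)])+)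
      (simp add: algebra_simps)
  finally show ?case
    using k by (simp add: G_def)
qed

text \<open>The term with the factor \<open>z\<close> vanishes at \<open>0\<close>, so the value is
  \<open>p * (p - 1) * ... * (p - m + 1)\<close>.\<close>

lemma deriv_cofactor_at_0:
  assumes "g 0 = 1" "m \<le> p"
  shows "\<exists>c>0. deriv_cofactor p g m 0 = of_real c"
  using assms(2)
proof (induction m)
  case 0
  show ?case
    using assms(1) by (intro exI[of _ 1]) simp
next
  case (Suc m)
  then obtain c where c: "c > 0" "deriv_cofactor p g m 0 = of_real c"
    by auto
  then show ?case
    using Suc.prems by (intro exI[of _ "real (p - m) * c"]) auto
qed

lemma power_series_cofactor:
  fixes a :: "nat \<Rightarrow> complex"
  assumes "p > 0"
    and sums: "\<And>z. z \<in> ball 0 1 \<Longrightarrow> (\<lambda>n. a (n + (p + 1)) * z ^ (n + (p + 1))) sums (f z - z ^ p)"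
  obtains g where "g holomorphic_on ball 0 1" "g 0 = 1" "\<And>z. z \<in> ball 0 1 \<Longrightarrow> f z = z ^ p * g z"
proof
  define g where "g = (\<lambda>z. if z = 0 then 1 else f z / z ^ p)"
  define b where "b = (\<lambda>n. if n = 0 then 1 else a (n + p))"
  have b0: "b 0 = 1"
    by (simp add: b_def)
  show "g holomorphic_on ball 0 1"
  proof (rule power_series_holomorphic)
    fix z :: complex assume z: "z \<in> ball 0 1"
    have "(\<lambda>n. b n * z ^ n) sums g z"
    proof (cases "z = 0")
      case True
      then show ?thesis
        using powser_sums_zero[of b] b0 by (simp add: g_def del: powser_sums_zero_iff)
    next
      case False
      have "(\<lambda>n. b (Suc n) * z ^ Suc n) sums (f z / z ^ p - 1)"
        using sums_divide[OF sums[OF z], of "z ^ p"] False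
        by (simp add: b_def power_add diff_divide_distrib mult_ac)
      then show ?thesis
        using sums_Suc[of "\<lambda>n. b n * z ^ n" "f z / z ^ p - 1"] False b0 by (simp add: g_def)
    qed
    then show "(\<lambda>n. b n * (z - 0) ^ n) sums g z"
      by simp
  qed
  show "g 0 = 1"
    by (simp add: g_def)
  show "f z = z ^ p * g z" if "z \<in> ball 0 1" for z
  proof (cases "z = 0")
    case True
    \<comment> \<open>All terms of the series vanish at \<open>0\<close>, so
      \<open>f 0 = 0 ^ p = 0\<close>.\<close>
    then show ?thesis
      using sums[of 0] \<open>p > 0\<close> sums_unique2[OF _ sums_zero] by fastforce
  qed (simp add: g_def)
qed

theorem corollary2p2:
  fixes p :: nat and f :: "complex \<Rightarrow> complex" and a :: "nat \<Rightarrow> complex"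
  assumes "p \<ge> 1"
    and "f analytic_on ball 0 1"
    and "\<And>z. z \<in> ball 0 1 \<Longrightarrow> (\<lambda>n. a (n + (p + 1)) * z ^ (n + (p + 1))) sums (f z - z ^ p)"
    and "\<And>z. z \<in> ball 0 1 \<Longrightarrow> abs_arg_less ((deriv ^^ p) f z) (3 * pi / 4)"
  shows "(\<forall>z\<in>ball 0 1. abs_arg_less (deriv_quotient f (p - 1) 1 z) (pi / 2)) \<and>
         (\<forall>z\<in>ball 0 1. \<forall>k\<in>{0..p - 1}. Re (deriv_quotient f (p - k - 1) (k + 1) z) > 0) \<and>
         (p \<ge> 2 \<longrightarrow> p_valent_on p f (ball 0 1))"
proof -
  have "p > 0"
    using assms(1) by simp
  obtain g where holg: "g holomorphic_on ball 0 1" and "g 0 = 1"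
    and f: "\<And>z. z \<in> ball 0 1 \<Longrightarrow> f z = z ^ p * g z"
    using power_series_cofactor[OF \<open>p > 0\<close> assms(3)] by metis
  define G where "G = deriv_cofactor p g"
  have holG: "G m holomorphic_on ball 0 1" for m
    unfolding G_def using holg by (intro holomorphic_deriv_cofactor) auto
  have deriv_f: "(deriv ^^ m) f z = z ^ (p - m) * G m z" if "m \<le> p" "z \<in> ball 0 1" for m z
    unfolding G_def using higher_deriv_cofactor[OF open_ball holg f that] .
  have G0: "\<exists>c>0. G m 0 = of_real c" if "m \<le> p" for m
    unfolding G_def using deriv_cofactor_at_0[of g] \<open>g 0 = 1\<close> that by blast
  have G_Suc: "G (Suc m) z = of_nat (p - m) * G m z + z * deriv (G m) z" for m z
    by (simp add: G_def)
  \<comment> \<open>For \<open>m = p - 1\<close> the coefficient \<open>p - m\<close> is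
    \<open>1\<close>, and \<open>G p\<close> is the \<open>p\<close>-th derivative of
    \<open>f\<close>, to which the sector hypothesis applies.\<close>
  have top: "Re (G (p - 1) z) > 0" if z: "z \<in> ball 0 1" for z
  proof -
    obtain c where "c > 0" "G (p - 1) 0 = of_real c"
      using G0[of "p - 1"] by auto
    moreover have "abs_arg_less (G (p - 1) u + u * deriv (G (p - 1)) u) (3 * pi / 4)"
      if "u \<in> ball 0 1" for u
      using assms(4)[OF that] deriv_f[OF order_refl that] G_Suc[of "p - 1" u] \<open>p > 0\<close> by simp
    ultimately show ?thesis
      using Re_pos_of_abs_arg_less[OF holG] z by blast
  qed
  \<comment> \<open>Positivity passes downwards from \<open>G (Suc m)\<close> to \<open>G m\<close>,
    starting at \<open>p - 1\<close>.\<close>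
  have pos: "\<forall>z\<in>ball 0 1. Re (G m z) > 0" if "m \<le> p - 1" for m
    using that
  proof (induction m rule: inc_induct)
    case base
    then show ?case
      using top by blast
  next
    case (step m)
    obtain c where "c > 0" "G m 0 = of_real c"
      using G0[of m] step.hyps by (meson diff_le_self le_trans less_imp_le)
    moreover have "0 < p - m"
      using step.hyps by simp
    moreover have "Re (of_nat (p - m) * G m u + u * deriv (G m) u) > 0" if "u \<in> ball 0 1" for u
      using step.IH that G_Suc[of m u] by metis
    ultimately show ?case
      using Re_pos_of_euler_sum[OF holG] by blast
  qed
  have quotient: "deriv_quotient f (p - k - 1) (k + 1) z = G (p - k - 1) z"
    if "k \<in> {0..p - 1}" "z \<in> ball 0 1" for k z
  proof (rule deriv_quotient_eq[OF holG that(2)])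
    have "p - (p - k - 1) = k + 1"
      using that(1) \<open>p > 0\<close> by auto
    then show "(deriv ^^ (p - k - 1)) f u = u ^ (k + 1) * G (p - k - 1) u" if "u \<in> ball 0 1" for u
      using deriv_f[OF _ that, of "p - k - 1"] by simp
  qed
  have "Re (deriv_quotient f (p - k - 1) (k + 1) z) > 0" if "k \<in> {0..p - 1}" "z \<in> ball 0 1" for k z
    using quotient[OF that] pos[of "p - k - 1"] that by simp
  moreover have "abs_arg_less (deriv_quotient f (p - 1) 1 z) (pi / 2)" if "z \<in> ball 0 1" for z
    using quotient[OF _ that, of 0] top[OF that] by (simp add: abs_arg_less_pi_half_iff)
  moreover have "p_valent_on p f (ball 0 1)" if "p \<ge> 2"
  proof (rule p_valent_on_of_Re_pos[OF f holg _ \<open>p > 0\<close>])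
    show "g z \<noteq> 0" if "z \<in> ball 0 1" for z
      using pos[of 0] that by (force simp: G_def)
    show "f holomorphic_on ball 0 1"
      using assms(2) by (rule analytic_imp_holomorphic)
    show "z * deriv f z = z ^ p * G 1 z" if "z \<in> ball 0 1" for z
      using deriv_f[of 1 z] that \<open>p > 0\<close> by (simp add: power_eq_if)
    \<comment> \<open>Here \<open>p \<ge> 2\<close> enters: it places the index \<open>1\<close> in
      the range \<open>m \<le> p - 1\<close>.\<close>
    show "Re (G 1 z) > 0" if "z \<in> ball 0 1" for z
      using pos[of 1] that \<open>p \<ge> 2\<close> by simp
  qed
  ultimately show ?thesis
    by blast
qed

end
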